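(* Let $d\ge 3$. There is no polynomial coherence measure $C_p$ on $\mathcal{H}_d=\mathbb{C}^d$ that satisfies the following criterion $(C1')$: for every density matrix $\delta$ on $\mathcal{H}_d$, $C_p(\delta)=0$ if and only if $\delta$ is an incoherent state.
   Context: Fix the reference orthonormal basis $\{|i\rangle\}_{i=1,\dots,d}$ of $\mathcal{H}_d=\mathbb{C}^d$. A density matrix $\delta$ is incoherent if it is diagonal in this basis, $\delta=\sum_{i=1}^d p_i|i\rangle\langle i|$. Polynomial coherence measure: let $P_h$ be a homogeneous polynomial of degree $h\ge 1$ with complex coefficients in the coefficients of a vector $|\psi\rangle=\sum_{i=1}^d a_i|i\rangle$, i.e. $P_h(|\psi\rangle)=\sum_{k_1+\cdots+k_d=h}\chi_{k_1\cdots k_d}\prod_{i=1}^d a_i^{k_i}$ with nonnegative integers $k_i$, and let $m>0$ be real. The corresponding measure on pure states (unit vectors) is $C_p(|\psi\rangle)=|P_h(|\psi\rangle)|^m$. It is extended to density matrices by the convex roof $C_p(\rho)=\min_{\{p_i,|\psi_i\rangle\}}\sum_i p_i C_p(|\psi_i\rangle)$, the minimum running over all (finite) pure-state decompositions $\rho=\sum_i p_i|\psi_i\rangle\langle\psi_i|$ with $p_i\ge 0$, $\sum_i p_i=1$; in particular $C_p(|\psi\rangle\langle\psi|)=C_p(|\psi\rangle)$. *)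

theory Defs
  imports "HOL-Analysis.Analysis"
begin

type_synonym 'd cvec = "complex ^ 'd"
type_synonym 'd cmat = "complex ^ 'd ^ 'd"

definition ketbra :: "'d::finite cvec \<Rightarrow> 'd cmat" where
  "ketbra \<psi> = (\<chi> i j. \<psi> $ i * cnj (\<psi> $ j))"

(* The quadratic form is real by the first conjunct, so comparing its real part suffices. *)
definition density_matrix :: "'d::finite cmat \<Rightarrow> bool" where
  "density_matrix \<rho> \<longleftrightarrow>
     (\<forall>i j. \<rho> $ i $ j = cnj (\<rho> $ j $ i)) \<and>
     (\<forall>v. 0 \<le> Re (\<Sum>i\<in>UNIV. \<Sum>j\<in>UNIV. cnj (v $ i) * \<rho> $ i $ j * v $ j)) \<and>
     trace \<rho> = 1"

definition incoherent :: "'d::finite cmat \<Rightarrow> bool" where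
  "incoherent \<delta> \<longleftrightarrow> density_matrix \<delta> \<and> (\<forall>i j. i \<noteq> j \<longrightarrow> \<delta> $ i $ j = 0)"

(* A multi-index is a function on the index type; the sum below ranges over a finite set
   (finite_multi_indices), and only the values of c on multi-indices of total degree h matter. *)
definition hom_poly :: "nat \<Rightarrow> (('d::finite \<Rightarrow> nat) \<Rightarrow> complex) \<Rightarrow> 'd cvec \<Rightarrow> complex" where
  "hom_poly h c \<psi> = (\<Sum>k | (\<Sum>i\<in>UNIV. k i) = h. c k * (\<Prod>i\<in>UNIV. (\<psi> $ i) ^ k i))"

lemma finite_multi_indices: "finite {k :: 'd::finite \<Rightarrow> nat. (\<Sum>i\<in>UNIV. k i) = h}"
proof (rule finite_subset)
  show "{k :: 'd \<Rightarrow> nat. (\<Sum>i\<in>UNIV. k i) = h} \<subseteq> (\<Pi>\<^sub>E i\<in>UNIV. {..h})"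
    by (auto simp: PiE_def extensional_def intro!: member_le_sum)
  show "finite (\<Pi>\<^sub>E i\<in>(UNIV :: 'd set). {..h})"
    by (intro finite_PiE) auto
qed

definition Cp_pure :: "nat \<Rightarrow> (('d::finite \<Rightarrow> nat) \<Rightarrow> complex) \<Rightarrow> real \<Rightarrow> 'd cvec \<Rightarrow> real" where
  "Cp_pure h c m \<psi> = cmod (hom_poly h c \<psi>) powr m"

definition pure_decomposition ::
    "'d::finite cmat \<Rightarrow> nat \<Rightarrow> (nat \<Rightarrow> real) \<Rightarrow> (nat \<Rightarrow> 'd cvec) \<Rightarrow> bool" where
  "pure_decomposition \<rho> n p \<psi> \<longleftrightarrow>
     (\<forall>i<n. 0 \<le> p i \<and> norm (\<psi> i) = 1) \<and> (\<Sum>i<n. p i) = 1 \<and>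
     \<rho> = (\<Sum>i<n. p i *\<^sub>R ketbra (\<psi> i))"

definition roof_values ::
    "nat \<Rightarrow> (('d::finite \<Rightarrow> nat) \<Rightarrow> complex) \<Rightarrow> real \<Rightarrow> 'd cmat \<Rightarrow> real set" where
  "roof_values h c m \<rho> =
     {\<Sum>i<n. p i * Cp_pure h c m (\<psi> i) | n p \<psi>. pure_decomposition \<rho> n p \<psi>}"

definition Cp :: "nat \<Rightarrow> (('d::finite \<Rightarrow> nat) \<Rightarrow> complex) \<Rightarrow> real \<Rightarrow> 'd cmat \<Rightarrow> real" where
  "Cp h c m \<rho> = (LEAST r. r \<in> roof_values h c m \<rho>)"

lemma continuous_Cp_pure:
  assumes "m > 0"
  shows "continuous_on S (Cp_pure h c m)"
  unfolding Cp_pure_def [abs_def] hom_poly_def using assms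
  by (intro continuous_on_powr' continuous_intros) auto

(* A decomposition of a density matrix exists by the spectral theorem, and whenever one exists
   the minimum is attained, so LEAST is meaningful. *)
lemma Cp_is_minimum:
  assumes "m > 0" "roof_values h c m \<rho> \<noteq> {}"
  shows "Cp h c m \<rho> \<in> roof_values h c m \<rho>"
    and "r \<in> roof_values h c m \<rho> \<Longrightarrow> Cp h c m \<rho> \<le> r"
proof -
  define K where "K = (\<lambda>\<psi>. (ketbra \<psi>, Cp_pure h c m \<psi>)) ` sphere 0 1"
  have "continuous_on (sphere 0 1) (\<lambda>\<psi>. (ketbra \<psi>, Cp_pure h c m \<psi>))"
    unfolding ketbra_def
    by (intro continuous_on_Pair continuous_Cp_pure assms continuous_on_vec_lambda continuous_intros)
  then have "compact (convex hull K)"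
    unfolding K_def by (intro compact_convex_hull compact_continuous_image) auto
  then have "compact (convex hull K \<inter> {\<rho>} \<times> UNIV)"
    by (intro compact_Int_closed closed_Times) auto
  then have "compact (snd ` (convex hull K \<inter> {\<rho>} \<times> UNIV))"
    by (intro compact_continuous_image continuous_intros)
  moreover have "snd ` (convex hull K \<inter> {\<rho>} \<times> UNIV) = roof_values h c m \<rho>"
  proof (intro subset_antisym subsetI)
    fix r assume "r \<in> snd ` (convex hull K \<inter> {\<rho>} \<times> UNIV)"
    then have "(\<rho>, r) \<in> convex hull K" by auto
    then obtain n u x where *: "\<forall>i\<in>{1..n::nat}. 0 \<le> u i \<and> x i \<in> K" "sum u {1..n} = 1"
        "(\<Sum>i = 1..n. u i *\<^sub>R x i) = (\<rho>, r)"
      unfolding convex_hull_indexed by blast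
    then obtain \<psi> where \<psi>: "\<And>i. i \<in> {1..n} \<Longrightarrow>
        norm (\<psi> i) = 1 \<and> x i = (ketbra (\<psi> i), Cp_pure h c m (\<psi> i))"
      unfolding K_def image_iff Bex_def mem_sphere_0 by metis
    have sh: "sum f {1..n} = (\<Sum>i<n. f (Suc i))" for f :: "nat \<Rightarrow> 'z::comm_monoid_add"
      by (simp add: sum.atLeast1_atMost_eq)
    have "\<rho> = (\<Sum>i = 1..n. u i *\<^sub>R fst (x i))" "r = (\<Sum>i = 1..n. u i *\<^sub>R snd (x i))"
      using arg_cong [OF *(3), of fst] arg_cong [OF *(3), of snd]
      by (simp_all add: fst_sum snd_sum)
    then have "pure_decomposition \<rho> n (u \<circ> Suc) (\<psi> \<circ> Suc)"
        "r = (\<Sum>i<n. (u \<circ> Suc) i * Cp_pure h c m ((\<psi> \<circ> Suc) i))"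
      using *(1,2) \<psi> by (auto simp: pure_decomposition_def sh simp del: One_nat_def)
    then show "r \<in> roof_values h c m \<rho>"
      unfolding roof_values_def by blast
  next
    fix r assume "r \<in> roof_values h c m \<rho>"
    then obtain n p \<psi> where *: "pure_decomposition \<rho> n p \<psi>"
        "r = (\<Sum>i<n. p i * Cp_pure h c m (\<psi> i))"
      unfolding roof_values_def by blast
    have "(\<Sum>i<n. p i *\<^sub>R (ketbra (\<psi> i), Cp_pure h c m (\<psi> i))) \<in> convex hull K"
      using *(1) unfolding pure_decomposition_def
      by (intro convex_sum) (auto simp: K_def intro!: hull_inc)
    moreover have "(\<Sum>i<n. p i *\<^sub>R (ketbra (\<psi> i), Cp_pure h c m (\<psi> i))) = (\<rho>, r)"
      using * by (simp add: pure_decomposition_def prod_eq_iff fst_sum snd_sum)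
    ultimately show "r \<in> snd ` (convex hull K \<inter> {\<rho>} \<times> UNIV)"
      by force
  qed
  ultimately obtain s where s: "s \<in> roof_values h c m \<rho>" "\<And>t. t \<in> roof_values h c m \<rho> \<Longrightarrow> s \<le> t"
    using compact_attains_inf assms(2) by metis
  then have "Cp h c m \<rho> = s"
    unfolding Cp_def by (intro Least_equality)
  with s show "Cp h c m \<rho> \<in> roof_values h c m \<rho>"
    "r \<in> roof_values h c m \<rho> \<Longrightarrow> Cp h c m \<rho> \<le> r" by auto
qed

definition C1' :: "('d::finite cmat \<Rightarrow> real) \<Rightarrow> bool" where
  "C1' C \<longleftrightarrow> (\<forall>\<delta>. density_matrix \<delta> \<longrightarrow> (C \<delta> = 0 \<longleftrightarrow> incoherent \<delta>))"

end

(* A zero of the polynomial at a unit vector psi gives a one-term decomposition of its projector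
   with value 0, so (C1') forces psi to be a multiple of a basis vector.  But over the complex
   numbers a form of positive degree vanishes at a nonzero vector of every two-dimensional
   subspace, and as d is at least 3 there is a two-dimensional subspace containing no multiple of
   a basis vector: the span of e_x + e_y and e_y + e_z. *)

theory Submission
  imports Defs "HOL-Computational_Algebra.Fundamental_Theorem_Algebra"
begin

lemma hom_poly_scale: "hom_poly h c (s *s v) = s ^ h * hom_poly h c v"
proof -
  have "c k * (\<Prod>i\<in>UNIV. ((s *s v) $ i) ^ k i) = s ^ h * (c k * (\<Prod>i\<in>UNIV. (v $ i) ^ k i))"
    if "(\<Sum>i\<in>UNIV. k i) = h" for k
    using that by (auto simp: power_mult_distrib prod.distrib power_sum)
  then show ?thesis
    unfolding hom_poly_def sum_distrib_left by (intro sum.cong) auto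
qed

lemma hom_poly_on_line_is_poly:
  obtains q where "\<And>s. poly q s = hom_poly h c (v + s *s w)"
proof (rule that)
  fix s
  \<comment> \<open>Coefficients are listed in ascending order, so the linear factor
    \<open>[:v $ i, w $ i:]\<close> is the \<open>i\<close>-th coordinate of the moving
    point.\<close>
  show "poly (\<Sum>k | (\<Sum>i\<in>UNIV. k i) = h. [:c k:] * (\<Prod>i\<in>UNIV. [:v $ i, w $ i:] ^ k i)) s
      = hom_poly h c (v + s *s w)"
    by (simp add: hom_poly_def poly_sum poly_prod)
qed

text \<open>Without such a zero, the restrictions to the affine lines \<open>v + s *s w\<close> and
  \<open>w + s *s v\<close> are polynomials in \<open>s\<close> without roots, hence constant over
  the complex numbers. Homogeneity links the two lines by a factor \<open>2 ^ h\<close>, which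
  forces \<open>2 ^ h = 1\<close>.\<close>

lemma hom_poly_zero_on_line:
  assumes "h \<ge> 1"
  obtains s t where "s \<noteq> 0 \<or> t \<noteq> 0" "hom_poly h c (s *s v + t *s w) = 0"
proof (rule ccontr)
  assume "\<not> thesis"
  then have nz: "hom_poly h c (s *s v + t *s w) \<noteq> 0" if "s \<noteq> 0 \<or> t \<noteq> 0" for s t
    using that \<open>\<And>s t. s \<noteq> 0 \<or> t \<noteq> 0 \<Longrightarrow> hom_poly h c (s *s v + t *s w) = 0 \<Longrightarrow> thesis\<close> by blast
  obtain q where q: "\<And>s. poly q s = hom_poly h c (v + s *s w)"
    using hom_poly_on_line_is_poly[of h c v w] by blast
  obtain r where r: "\<And>s. poly r s = hom_poly h c (w + s *s v)"
    using hom_poly_on_line_is_poly[of h c w v] by blast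
  have "poly q s \<noteq> 0" "poly r s \<noteq> 0" for s
    using nz[of 1 s] nz[of s 1] by (simp_all add: q r add.commute)
  then have const: "constant (poly q)" "constant (poly r)"
    using fundamental_theorem_of_algebra by blast+
  \<comment> \<open>The parameters 2 and 1/2 give proportional points of the two lines; at parameter
    1 both lines pass through \<open>v + w\<close>.\<close>
  have "w + 2 *s v = 2 *s (v + (1 / 2) *s w)"
    by (simp add: vec_eq_iff algebra_simps)
  then have "poly r 2 = 2 ^ h * poly q (1 / 2)"
    by (simp only: q r hom_poly_scale)
  moreover have "poly r 2 = poly r 1" "poly q (1 / 2) = poly q 1"
    using const unfolding constant_def by blast+
  moreover have "poly r 1 = poly q 1"
    by (simp add: q r add.commute)
  ultimately have "(2::complex) ^ h = 1"
    using \<open>poly q 1 \<noteq> 0\<close> by simp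
  then have "cmod (2 ^ h) = 1"
    by simp
  then have "(2::real) ^ h = 1"
    by (simp add: norm_power)
  moreover have "(2::real) ^ h > 1"
    using assms by (intro one_less_power) auto
  ultimately show False
    by simp
qed

lemma norm_eq_1_iff_sum:
  fixes \<psi> :: "'d::finite cvec"
  shows "norm \<psi> = 1 \<longleftrightarrow> (\<Sum>i\<in>UNIV. (cmod (\<psi> $ i))\<^sup>2) = 1"
  by (simp add: norm_vec_def L2_set_def)

lemma density_matrix_ketbra:
  fixes \<psi> :: "'d::finite cvec"
  assumes "norm \<psi> = 1"
  shows "density_matrix (ketbra \<psi>)"
proof -
  have "0 \<le> Re (\<Sum>i\<in>UNIV. \<Sum>j\<in>UNIV. cnj (v $ i) * ketbra \<psi> $ i $ j * v $ j)" for v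
  proof -
    \<comment> \<open>The quadratic form of a projector factors as the squared modulus of the inner
      product of \<open>v\<close> and \<open>\<psi>\<close>.\<close>
    define z where "z = (\<Sum>i\<in>UNIV. cnj (v $ i) * \<psi> $ i)"
    have "(\<Sum>i\<in>UNIV. \<Sum>j\<in>UNIV. cnj (v $ i) * ketbra \<psi> $ i $ j * v $ j) = z * cnj z"
      by (simp add: z_def ketbra_def cnj_sum sum_product mult_ac)
    then show ?thesis
      by (simp add: complex_mult_cnj del: of_real_add of_real_power)
  qed
  moreover have "trace (ketbra \<psi>) = 1"
  proof -
    have "trace (ketbra \<psi>) = of_real (\<Sum>i\<in>UNIV. (cmod (\<psi> $ i))\<^sup>2)"
      by (simp add: trace_def ketbra_def complex_norm_square del: of_real_power)
    with assms show ?thesis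
      by (simp only: norm_eq_1_iff_sum) simp
  qed
  ultimately show ?thesis
    by (simp add: density_matrix_def ketbra_def)
qed

lemma Cp_ketbra_eq_0:
  assumes "norm \<psi> = 1" "hom_poly h c \<psi> = 0"
  shows "Cp h c m (ketbra \<psi>) = 0"
  unfolding Cp_def
proof (rule Least_equality)
  have "pure_decomposition (ketbra \<psi>) 1 (\<lambda>_. 1) (\<lambda>_. \<psi>)"
    using assms by (simp add: pure_decomposition_def)
  \<comment> \<open>Here \<open>0 powr m\<close> evaluates to 0.\<close>
  moreover have "0 = (\<Sum>i<1::nat. 1 * Cp_pure h c m \<psi>)"
    using assms by (simp add: Cp_pure_def)
  ultimately show "0 \<in> roof_values h c m (ketbra \<psi>)"
    unfolding roof_values_def mem_Collect_eq by (intro exI conjI)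
next
  fix r assume "r \<in> roof_values h c m (ketbra \<psi>)"
  then show "0 \<le> r"
    unfolding roof_values_def pure_decomposition_def
    by (auto simp: Cp_pure_def intro!: sum_nonneg)
qed

text \<open>The off-diagonal entries of the projector onto the normalised vector are products of one
  coordinate with the conjugate of another, and incoherence makes them vanish.\<close>

lemma hom_poly_zero_imp_coordinate:
  assumes C: "C1' (Cp h c m)" and z: "hom_poly h c \<psi> = 0" and "i \<noteq> j"
  shows "\<psi> $ i = 0 \<or> \<psi> $ j = 0"
proof (cases "\<psi> = 0")
  case False
  \<comment> \<open>The complex scaling fits \<open>hom_poly_scale\<close>; its real form below
    serves to compute the norm.\<close>
  define \<phi> where "\<phi> = complex_of_real (1 / norm \<psi>) *s \<psi>"
  have \<phi>: "\<phi> = (1 / norm \<psi>) *\<^sub>R \<psi>"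
    by (simp add: \<phi>_def vec_eq_iff scaleR_conv_of_real[where 'a = complex])
  have n: "norm \<phi> = 1"
    using False by (simp add: \<phi>)
  have "hom_poly h c \<phi> = 0"
    unfolding \<phi>_def hom_poly_scale z by simp
  then have "incoherent (ketbra \<phi>)"
    using C n density_matrix_ketbra Cp_ketbra_eq_0 unfolding C1'_def by blast
  then have "\<phi> $ i * cnj (\<phi> $ j) = 0"
    using \<open>i \<noteq> j\<close> by (simp add: incoherent_def ketbra_def)
  then show ?thesis
    using False by (auto simp: \<phi>)
qed simp

theorem theorem1:
  assumes "CARD('d::finite) \<ge> 3"
  shows "\<not> (\<exists>(h::nat) (c :: ('d \<Rightarrow> nat) \<Rightarrow> complex) (m::real).
            h \<ge> 1 \<and> m > 0 \<and> C1' (Cp h c m))"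
proof (rule notI, elim exE conjE)
  fix h m and c :: "('d \<Rightarrow> nat) \<Rightarrow> complex"
  assume h: "h \<ge> 1" and C: "C1' (Cp h c m)"
  obtain A :: "'d set" where "card A = 3"
    using obtain_subset_with_card_n[OF assms] by blast
  then obtain x y z :: 'd where xyz: "x \<noteq> y" "x \<noteq> z" "y \<noteq> z"
    by (auto simp: card_3_iff)
  obtain s t where st: "s \<noteq> 0 \<or> t \<noteq> 0"
    and "hom_poly h c (s *s (axis x 1 + axis y 1) + t *s (axis y 1 + axis z 1)) = 0"
    using hom_poly_zero_on_line[OF h] by metis
  note coord = hom_poly_zero_imp_coordinate[OF C this(2)]
  \<comment> \<open>The coordinates at \<open>x\<close>, \<open>y\<close>, \<open>z\<close> are
    \<open>s\<close>, \<open>s + t\<close>, \<open>t\<close>. If two of these vanish, so do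
    \<open>s\<close> and \<open>t\<close>.\<close>
  have "s = 0 \<or> s + t = 0" "s = 0 \<or> t = 0" "s + t = 0 \<or> t = 0"
    using coord[OF xyz(1)] coord[OF xyz(2)] coord[OF xyz(3)] xyz
    by (auto simp: axis_def)
  with st show False
    by auto
qed

end
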